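(* For each positive integer $m$, let $N_m$ be the cardinality of the minimal square-free left cycle set of multipermutational level $m$. For each positive integer $k$, let $\bar{N}_k$ be the cardinality of the minimal square-free left cycle set $X$ of multipermutational level $k$ such that there exist an automorphism $\alpha$ of $X$ and an element $x\in X$ with $\sigma_{[k-1]}(x)\neq \sigma_{[k-1]}(\alpha(x))$. Then the inequality $$N_m\leq \bar{N}_k\cdot 2^{m-k-1}+1$$ holds for all positive integers $k<m$.
   Context: A left cycle set is a non-empty set $X$ with a binary operation $\cdot$ such that every left multiplication $\sigma_x:X\to X$, $y\mapsto x\cdot y$, is bijective and $(x\cdot y)\cdot(x\cdot z)=(y\cdot x)\cdot(y\cdot z)$ for all $x,y,z\in X$. It is non-degenerate if the squaring map $x\mapsto x\cdot x$ is bijective; by convention, "left cycle set" always means non-degenerate left cycle set. It is square-free if $x\cdot x=x$ for all $x\in X$. The retraction of $X$ is the set $\sigma(X)=\{\sigma_x : x\in X\}\subseteq \mathrm{Sym}(X)$ with the (well-defined) operation $\sigma_x\cdot\sigma_y:=\sigma_{x\cdot y}$; it is again a non-degenerate left cycle set. Put $\sigma^0(X):=X$ and $\sigma^n(X):=\sigma(\sigma^{n-1}(X))$ for $n\geq 1$. $X$ is multipermutational of level $m$ (written $mpl(X)=m$) if $m$ is the minimal non-negative integer such that $\sigma^m(X)$ has cardinality one. The epimorphism $\sigma_{[n]}:X\to\sigma^n(X)$ is defined inductively by $\sigma_{[0]}(x):=x$ and $\sigma_{[n]}(x):=\sigma_{\sigma_{[n-1]}(x)}$, the left multiplication by $\sigma_{[n-1]}(x)$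 in $\sigma^{n-1}(X)$. An automorphism of $X$ is a bijection $\alpha:X\to X$ with $\alpha(x\cdot y)=\alpha(x)\cdot\alpha(y)$ for all $x,y\in X$. *)

theory Defs
  imports Main "HOL-Library.FSet"
begin

text \<open>A set with a binary operation is given as a pair of a carrier and an operation, which is
  only relevant on the carrier.\<close>

type_synonym 'a magma = "'a set \<times> ('a \<Rightarrow> 'a \<Rightarrow> 'a)"

abbreviation carr :: "'a magma \<Rightarrow> 'a set" where "carr \<equiv> fst"

abbreviation opn :: "'a magma \<Rightarrow> 'a \<Rightarrow> 'a \<Rightarrow> 'a" where "opn \<equiv> snd"

text \<open>As usual, non-degeneracy (bijectivity of the squaring map) is part of the notion.\<close>

definition left_cycle_set :: "'a magma \<Rightarrow> bool" where
  "left_cycle_set X \<longleftrightarrow>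
     carr X \<noteq> {} \<and>
     (\<forall>x\<in>carr X. bij_betw (opn X x) (carr X) (carr X)) \<and>
     (\<forall>x\<in>carr X. \<forall>y\<in>carr X. \<forall>z\<in>carr X.
        opn X (opn X x y) (opn X x z) = opn X (opn X y x) (opn X y z)) \<and>
     bij_betw (\<lambda>x. opn X x x) (carr X) (carr X)"

definition square_free :: "'a magma \<Rightarrow> bool" where
  "square_free X \<longleftrightarrow> (\<forall>x\<in>carr X. opn X x x = x)"

definition automorphism :: "'a magma \<Rightarrow> ('a \<Rightarrow> 'a) \<Rightarrow> bool" where
  "automorphism X \<alpha> \<longleftrightarrow>
     bij_betw \<alpha> (carr X) (carr X) \<and>
     (\<forall>x\<in>carr X. \<forall>y\<in>carr X. \<alpha> (opn X x y) = opn X (\<alpha> x) (\<alpha> y))"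

text \<open>The elements of the retraction of \<open>X\<close> are permutations of \<open>X\<close>, so in simple type theory each
  retraction step would change the type of the elements. To be able to iterate, we use a
  type of elements that contains infinitely many atoms and is closed under forming (graphs of)
  functions between finite sets of elements. Every finite set is in bijection with a subset of
  this type. The constructions below are meant for finite carriers only.\<close>

datatype elt = Atom nat | Graph "(elt \<times> elt) fset"

text \<open>The left multiplication by \<open>x\<close>, as a map on the carrier.\<close>

definition lmul :: "elt magma \<Rightarrow> elt \<Rightarrow> elt" where
  "lmul X x = Graph (Abs_fset ((\<lambda>y. (y, opn X x y)) ` carr X))"

text \<open>The operation is defined through representatives; see \<open>opn_cs_retraction\<close> below for
  the independence of their choice.\<close>

definition cs_retraction :: "elt magma \<Rightarrow> elt magma" where
  "cs_retraction X =
     (lmul X ` carr X,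
      \<lambda>p q. lmul X (opn X (inv_into (carr X) (lmul X) p) (inv_into (carr X) (lmul X) q)))"

primrec iter_retraction :: "nat \<Rightarrow> elt magma \<Rightarrow> elt magma" where
  "iter_retraction 0 X = X"
| "iter_retraction (Suc n) X = cs_retraction (iter_retraction n X)"

primrec iter_sigma :: "nat \<Rightarrow> elt magma \<Rightarrow> elt \<Rightarrow> elt" where
  "iter_sigma 0 X x = x"
| "iter_sigma (Suc n) X x = lmul (iter_retraction n X) (iter_sigma n X x)"

definition multiperm_level :: "elt magma \<Rightarrow> nat \<Rightarrow> bool" where
  "multiperm_level X m \<longleftrightarrow>
     card (carr (iter_retraction m X)) = 1 \<and>
     (\<forall>j<m. card (carr (iter_retraction j X)) \<noteq> 1)"

text \<open>Finite square-free left cycle sets of every level exist, so the least cardinalities below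
  are attained by finite ones; without the finiteness condition infinite carriers would have
  \<open>card\<close> equal to \<open>0\<close>.\<close>

definition N_min :: "nat \<Rightarrow> nat" where
  "N_min m = (LEAST n. \<exists>X. finite (carr X) \<and> card (carr X) = n \<and>
     left_cycle_set X \<and> square_free X \<and> multiperm_level X m)"

definition Nbar_min :: "nat \<Rightarrow> nat" where
  "Nbar_min k = (LEAST n. \<exists>X. finite (carr X) \<and> card (carr X) = n \<and>
     left_cycle_set X \<and> square_free X \<and> multiperm_level X k \<and>
     (\<exists>\<alpha>. automorphism X \<alpha> \<and>
        (\<exists>x\<in>carr X. iter_sigma (k - 1) X x \<noteq> iter_sigma (k - 1) X (\<alpha> x))))"

lemma lmul_eq_iff:
  assumes "finite (carr X)"
  shows "lmul X x = lmul X y \<longleftrightarrow> (\<forall>z\<in>carr X. opn X x z = opn X y z)"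
proof -
  have "lmul X x = lmul X y \<longleftrightarrow>
      (\<lambda>z. (z, opn X x z)) ` carr X = (\<lambda>z. (z, opn X y z)) ` carr X"
    unfolding lmul_def using assms by (simp add: Abs_fset_inject)
  also have "\<dots> \<longleftrightarrow> (\<forall>z\<in>carr X. opn X x z = opn X y z)"
    by (auto simp: image_iff set_eq_iff)
  finally show ?thesis .
qed

lemma opn_cs_retraction:
  assumes fin: "finite (carr X)" and X: "left_cycle_set X"
    and x: "x \<in> carr X" and y: "y \<in> carr X"
  shows "opn (cs_retraction X) (lmul X x) (lmul X y) = lmul X (opn X x y)"
proof -
  define x' where "x' = inv_into (carr X) (lmul X) (lmul X x)"
  define y' where "y' = inv_into (carr X) (lmul X) (lmul X y)"
  have x': "x' \<in> carr X" "lmul X x' = lmul X x"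
    unfolding x'_def using x by (auto intro: inv_into_into f_inv_into_f)
  have y': "y' \<in> carr X" "lmul X y' = lmul X y"
    unfolding y'_def using y by (auto intro: inv_into_into f_inv_into_f)
  have ex: "opn X x' z = opn X x z" and ey: "opn X y' z = opn X y z" if "z \<in> carr X" for z
    using x'(2) y'(2) that lmul_eq_iff[OF fin] by auto
  have cyc: "opn X (opn X a b) (opn X a c) = opn X (opn X b a) (opn X b c)"
    if "a \<in> carr X" "b \<in> carr X" "c \<in> carr X" for a b c
    using X that unfolding left_cycle_set_def by blast
  have surj: "opn X x ` carr X = carr X"
    using X x unfolding left_cycle_set_def bij_betw_def by blast
  have "opn X (opn X x' y') w = opn X (opn X x y) w" if w: "w \<in> carr X" for w
  proof -
    obtain z where z: "z \<in> carr X" "w = opn X x z" using surj w by blast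
    have "opn X (opn X x' y') w = opn X (opn X x y') (opn X x z)"
      using z ex y'(1) by simp
    also have "\<dots> = opn X (opn X y' x) (opn X y' z)" using cyc x y'(1) z(1) by blast
    also have "\<dots> = opn X (opn X y x) (opn X y z)" using ey x z(1) by simp
    also have "\<dots> = opn X (opn X x y) w" using cyc[of x y z] x y z by simp
    finally show ?thesis .
  qed
  then have "lmul X (opn X x' y') = lmul X (opn X x y)" using lmul_eq_iff[OF fin] by blast
  then show ?thesis by (simp add: cs_retraction_def x'_def y'_def)
qed

end

theory Submission
  imports Defs
begin

text \<open>Two left cycle sets \<open>X\<close> and \<open>Y\<close> with automorphisms \<open>\<alpha>\<close> and \<open>\<beta>\<close> can be glued: on the disjoint
  union, elements of the same part multiply as before, every element of \<open>Y\<close> acts on \<open>X\<close> as \<open>\<alpha>\<close>, and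
  every element of \<open>X\<close> acts on \<open>Y\<close> as \<open>\<beta>\<close>. This is a left cycle set exactly because \<open>\<alpha>\<close> and \<open>\<beta>\<close>
  respect the operations. Its retraction is the gluing of the retractions, unless some left
  multiplication of \<open>X\<close> coincides with \<open>\<alpha>\<close> and some left multiplication of \<open>Y\<close> with \<open>\<beta>\<close>, in which
  case the parts get mixed up.

  Suppose that \<open>X\<close> is square-free of level \<open>k > 0\<close> and that \<open>\<alpha>\<close> moves some element of \<open>\<sigma>\<^sup>k\<^sup>-\<^sup>1(X)\<close>. All left
  multiplications of \<open>X\<close> induce the identity on \<open>\<sigma>\<^sup>k\<^sup>-\<^sup>1(X)\<close>, so \<open>\<alpha>\<close> is not induced by any of them on any
  \<open>\<sigma>\<^sup>n(X)\<close> with \<open>n < k\<close>. Hence the two parts stay apart during the first \<open>k\<close> retraction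
  steps; if \<open>\<sigma>\<^sup>k(Y)\<close> is a single point, then two points are left after them, which the next step
  identifies. So the gluing has level \<open>k + 1\<close>.

  Gluing \<open>X\<close> with a single point gives \<open>N_min (k + 1) \<le> Nbar_min k + 1\<close>. Gluing \<open>X\<close> with a copy of itself, both
  times with \<open>\<alpha>\<close>, gives a set on which the exchange of the two copies is an automorphism that swaps the
  two points of \<open>\<sigma>\<^sup>k\<close>; hence \<open>Nbar_min (k + 1) \<le> 2 * Nbar_min k\<close>. Iterating the second inequality from \<open>k\<close> to \<open>m - 1\<close> and
  then applying the first one yields the claim. The doubling, started from two points with trivial
  operation, also shows that the sets over which \<open>Nbar_min k\<close> is a minimum exist.

  Iterated retractions are handled through the equivalence relations \<open>\<sigma>\<^sub>[\<^sub>n\<^sub>](x) = \<sigma>\<^sub>[\<^sub>n\<^sub>](y)\<close> on \<open>X\<close>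
  itself, which satisfy a simple recursion in \<open>n\<close> (\<open>iter_sigma_Suc_eq_iff\<close>); the elements of the
  retractions then never have to be inspected.\<close>

section \<open>Iterated retractions as equivalence relations\<close>

lemma opn_closed:
  assumes "left_cycle_set X" and "x \<in> carr X" and "y \<in> carr X"
  shows "opn X x y \<in> carr X"
  using assms unfolding left_cycle_set_def bij_betw_def by blast

lemma cycle_law:
  assumes "left_cycle_set X" and "x \<in> carr X" and "y \<in> carr X" and "z \<in> carr X"
  shows "opn X (opn X x y) (opn X x z) = opn X (opn X y x) (opn X y z)"
  using assms unfolding left_cycle_set_def by blast

lemma automorphism_closed:
  assumes "automorphism X \<alpha>" and "x \<in> carr X"
  shows "\<alpha> x \<in> carr X"
  using assms unfolding automorphism_def bij_betw_def by blast

lemma carr_cs_retraction [simp]: "carr (cs_retraction X) = lmul X ` carr X"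
  by (simp add: cs_retraction_def)

text \<open>On a finite carrier the maps that have to be bijective only need to be surjective, and
  surjectivity passes to images.\<close>

lemma left_cycle_set_cs_retraction:
  assumes fin: "finite (carr X)" and X: "left_cycle_set X"
  shows "left_cycle_set (cs_retraction X)"
proof -
  let ?R = "cs_retraction X"
  note [simp] = opn_cs_retraction[OF fin X] opn_closed[OF X]
  have finR: "finite (carr ?R)" using fin by simp
  have bij: "bij_betw f (carr ?R) (carr ?R)"
    if g: "bij_betw g (carr X) (carr X)" and f: "\<And>x. x \<in> carr X \<Longrightarrow> f (lmul X x) = lmul X (g x)"
    for f g
  proof -
    have "f ` carr ?R = (\<lambda>x. lmul X (g x)) ` carr X"
      unfolding carr_cs_retraction image_image using f by (intro image_cong) auto
    also have "\<dots> = lmul X ` g ` carr X" by (simp add: image_image)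
    also have "\<dots> = carr ?R" using g by (simp add: bij_betw_def)
    finally have "f ` carr ?R = carr ?R" .
    then show ?thesis using finR by (simp add: bij_betw_def eq_card_imp_inj_on)
  qed
  have "bij_betw (opn ?R p) (carr ?R) (carr ?R)" if p: "p \<in> carr ?R" for p
  proof -
    obtain x where x: "x \<in> carr X" "p = lmul X x" using p by auto
    have "bij_betw (opn X x) (carr X) (carr X)" using X x unfolding left_cycle_set_def by blast
    then show ?thesis by (rule bij) (use x in simp)
  qed
  moreover have "bij_betw (\<lambda>p. opn ?R p p) (carr ?R) (carr ?R)"
  proof -
    have "bij_betw (\<lambda>x. opn X x x) (carr X) (carr X)" using X unfolding left_cycle_set_def by blast
    then show ?thesis by (rule bij) simp
  qed
  moreover have "opn ?R (opn ?R p q) (opn ?R p r) = opn ?R (opn ?R q p) (opn ?R q r)"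
    if pqr: "p \<in> carr ?R" "q \<in> carr ?R" "r \<in> carr ?R" for p q r
  proof -
    obtain x y z where "x \<in> carr X" "y \<in> carr X" "z \<in> carr X"
      and "p = lmul X x" "q = lmul X y" "r = lmul X z"
      using pqr by auto
    then show ?thesis using cycle_law[OF X, of x y z] by simp
  qed
  moreover have "carr ?R \<noteq> {}" using X by (simp add: left_cycle_set_def)
  ultimately show ?thesis unfolding left_cycle_set_def by blast
qed

lemma finite_left_cycle_set_iter_retraction:
  assumes "finite (carr X)" and "left_cycle_set X"
  shows "finite (carr (iter_retraction n X)) \<and> left_cycle_set (iter_retraction n X)"
  using assms by (induction n) (auto intro: left_cycle_set_cs_retraction)

lemma carr_iter_retraction: "carr (iter_retraction n X) = iter_sigma n X ` carr X"
  by (induction n) (auto simp: image_image)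

lemma iter_sigma_hom:
  assumes fin: "finite (carr X)" and X: "left_cycle_set X" and "x \<in> carr X" and "y \<in> carr X"
  shows "iter_sigma n X (opn X x y) = opn (iter_retraction n X) (iter_sigma n X x) (iter_sigma n X y)"
proof (induction n)
  case (Suc n)
  then show ?case
    using assms finite_left_cycle_set_iter_retraction[OF fin X, of n]
    by (simp add: opn_cs_retraction carr_iter_retraction)
qed simp

lemma iter_sigma_Suc_eq_iff:
  assumes fin: "finite (carr X)" and X: "left_cycle_set X" and x: "x \<in> carr X" and y: "y \<in> carr X"
  shows "iter_sigma (Suc n) X x = iter_sigma (Suc n) X y \<longleftrightarrow>
    (\<forall>z\<in>carr X. iter_sigma n X (opn X x z) = iter_sigma n X (opn X y z))"
  using finite_left_cycle_set_iter_retraction[OF fin X, of n] x y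
  by (simp add: lmul_eq_iff carr_iter_retraction iter_sigma_hom[OF fin X])

lemma iter_sigma_eq_mono:
  assumes "iter_sigma n X x = iter_sigma n X y" and "n \<le> n'"
  shows "iter_sigma n' X x = iter_sigma n' X y"
  using assms(2,1) by (induction n' rule: dec_induct) auto

lemma card_iter_retraction_eq_1_iff:
  assumes "left_cycle_set X"
  shows "card (carr (iter_retraction n X)) = 1 \<longleftrightarrow>
    (\<forall>x\<in>carr X. \<forall>y\<in>carr X. iter_sigma n X x = iter_sigma n X y)"
proof
  assume "card (carr (iter_retraction n X)) = 1"
  then obtain c where "iter_sigma n X ` carr X = {c}"
    by (auto simp: carr_iter_retraction card_1_singleton_iff)
  then show "\<forall>x\<in>carr X. \<forall>y\<in>carr X. iter_sigma n X x = iter_sigma n X y"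
    by (metis imageI singletonD)
next
  assume eq: "\<forall>x\<in>carr X. \<forall>y\<in>carr X. iter_sigma n X x = iter_sigma n X y"
  obtain x where "x \<in> carr X" using assms by (auto simp: left_cycle_set_def)
  with eq have "iter_sigma n X ` carr X = {iter_sigma n X x}" by blast
  then show "card (carr (iter_retraction n X)) = 1" by (simp add: carr_iter_retraction)
qed

lemma iter_sigma_eq_if_level:
  assumes "left_cycle_set X" and "multiperm_level X m" and "x \<in> carr X" and "y \<in> carr X"
  shows "iter_sigma m X x = iter_sigma m X y"
  using assms card_iter_retraction_eq_1_iff[of X m] unfolding multiperm_level_def by blast

text \<open>In a square-free set of level \<open>k + 1\<close>, the element \<open>x\<close> acts on the class of \<open>y\<close> in \<open>\<sigma>\<^sup>k(X)\<close> in the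
  same way as \<open>y\<close> itself does, and \<open>y\<close> fixes \<open>y\<close>.\<close>

lemma iter_sigma_opn_if_level_Suc:
  assumes "finite (carr X)" and "left_cycle_set X" and "square_free X"
    and "multiperm_level X (Suc k)" and "x \<in> carr X" and "y \<in> carr X"
  shows "iter_sigma k X (opn X x y) = iter_sigma k X y"
proof -
  have "iter_sigma (Suc k) X x = iter_sigma (Suc k) X y"
    using assms by (intro iter_sigma_eq_if_level) auto
  then have "iter_sigma k X (opn X x y) = iter_sigma k X (opn X y y)"
    using assms by (subst (asm) iter_sigma_Suc_eq_iff) auto
  then show ?thesis using assms by (simp add: square_free_def)
qed

section \<open>Gluing two left cycle sets along automorphisms\<close>

text \<open>Tagging every element realises the disjoint union inside the type of elements.\<close>

definition inl :: "elt \<Rightarrow> elt" where "inl x = Graph {|(Atom 0, x)|}"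
definition inr :: "elt \<Rightarrow> elt" where "inr x = Graph {|(Atom 1, x)|}"

definition case_tag :: "(elt \<Rightarrow> 'b) \<Rightarrow> (elt \<Rightarrow> 'b) \<Rightarrow> elt \<Rightarrow> 'b" where
  "case_tag f g p = (if p \<in> range inl then f (inv inl p) else g (inv inr p))"

lemma inl_eq_iff [simp]: "inl x = inl y \<longleftrightarrow> x = y"
  and inr_eq_iff [simp]: "inr x = inr y \<longleftrightarrow> x = y"
  and inl_neq_inr [simp]: "inl x \<noteq> inr y" "inr y \<noteq> inl x"
  by (auto simp: inl_def inr_def)

lemma case_tag_simps [simp]: "case_tag f g (inl x) = f x" "case_tag f g (inr x) = g x"
proof -
  have "inj inl" "inj inr" by (auto intro: injI)
  then show "case_tag f g (inl x) = f x" "case_tag f g (inr x) = g x"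
    by (auto simp: case_tag_def)
qed

definition glue :: "elt magma \<Rightarrow> (elt \<Rightarrow> elt) \<Rightarrow> elt magma \<Rightarrow> (elt \<Rightarrow> elt) \<Rightarrow> elt magma" where
  "glue X \<alpha> Y \<beta> =
     (inl ` carr X \<union> inr ` carr Y,
      case_tag (\<lambda>x. case_tag (\<lambda>z. inl (opn X x z)) (\<lambda>z. inr (\<beta> z)))
               (\<lambda>y. case_tag (\<lambda>z. inl (\<alpha> z)) (\<lambda>z. inr (opn Y y z))))"

lemma carr_glue [simp]: "carr (glue X \<alpha> Y \<beta>) = inl ` carr X \<union> inr ` carr Y"
  by (simp add: glue_def)

lemma opn_glue [simp]:
  "opn (glue X \<alpha> Y \<beta>) (inl x) (inl z) = inl (opn X x z)"
  "opn (glue X \<alpha> Y \<beta>) (inl x) (inr z) = inr (\<beta> z)"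
  "opn (glue X \<alpha> Y \<beta>) (inr y) (inl z) = inl (\<alpha> z)"
  "opn (glue X \<alpha> Y \<beta>) (inr y) (inr z) = inr (opn Y y z)"
  by (simp_all add: glue_def)

lemma card_glue:
  assumes "finite (carr X)" and "finite (carr Y)"
  shows "card (carr (glue X \<alpha> Y \<beta>)) = card (carr X) + card (carr Y)"
proof -
  have "card (inl ` carr X \<union> inr ` carr Y) = card (inl ` carr X) + card (inr ` carr Y)"
    using assms by (intro card_Un_disjoint) auto
  then show ?thesis by (simp add: card_image inj_on_def)
qed

lemma square_free_glue:
  assumes "square_free X" and "square_free Y"
  shows "square_free (glue X \<alpha> Y \<beta>)"
  using assms by (auto simp: square_free_def)

lemma bij_betw_inl_inr:
  assumes f: "bij_betw f A A'" and g: "bij_betw g B B'"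
    and h: "\<And>x. x \<in> A \<Longrightarrow> h (inl x) = inl (f x)" "\<And>y. y \<in> B \<Longrightarrow> h (inr y) = inr (g y)"
  shows "bij_betw h (inl ` A \<union> inr ` B) (inl ` A' \<union> inr ` B')"
proof (rule bij_betw_imageI)
  show "inj_on h (inl ` A \<union> inr ` B)"
    using h inj_on_eq_iff[OF bij_betw_imp_inj_on[OF f]] inj_on_eq_iff[OF bij_betw_imp_inj_on[OF g]]
    by (intro inj_onI) auto
  have "h ` inl ` A = inl ` f ` A" "h ` inr ` B = inr ` g ` B"
    unfolding image_image using h by (auto intro: image_cong)
  then show "h ` (inl ` A \<union> inr ` B) = inl ` A' \<union> inr ` B'"
    using f g by (simp add: image_Un bij_betw_imp_surj_on)
qed

text \<open>In the mixed cases the cycle law is \<open>\<alpha> (x \<cdot> z) = \<alpha> x \<cdot> \<alpha> z\<close>, or the same for \<open>\<beta>\<close>.\<close>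

lemma left_cycle_set_glue:
  assumes X: "left_cycle_set X" and Y: "left_cycle_set Y"
    and \<alpha>: "automorphism X \<alpha>" and \<beta>: "automorphism Y \<beta>"
  shows "left_cycle_set (glue X \<alpha> Y \<beta>)"
proof -
  let ?G = "glue X \<alpha> Y \<beta>"
  have bij: "bij_betw \<alpha> (carr X) (carr X)" "bij_betw \<beta> (carr Y) (carr Y)"
    using \<alpha> \<beta> by (auto simp: automorphism_def)
  have "bij_betw (opn ?G p) (carr ?G) (carr ?G)" if "p \<in> carr ?G" for p
  proof -
    from that consider (l) x where "x \<in> carr X" "p = inl x" | (r) y where "y \<in> carr Y" "p = inr y"
      by auto
    then show ?thesis
    proof cases
      case l
      then have "bij_betw (opn X x) (carr X) (carr X)" using X by (auto simp: left_cycle_set_def)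
      then show ?thesis unfolding carr_glue by (rule bij_betw_inl_inr[OF _ bij(2)]) (simp_all add: l)
    next
      case r
      then have "bij_betw (opn Y y) (carr Y) (carr Y)" using Y by (auto simp: left_cycle_set_def)
      then show ?thesis unfolding carr_glue by (rule bij_betw_inl_inr[OF bij(1)]) (simp_all add: r)
    qed
  qed
  moreover have "bij_betw (\<lambda>p. opn ?G p p) (carr ?G) (carr ?G)"
  proof -
    have "bij_betw (\<lambda>x. opn X x x) (carr X) (carr X)" "bij_betw (\<lambda>x. opn Y x x) (carr Y) (carr Y)"
      using X Y by (auto simp: left_cycle_set_def)
    then show ?thesis unfolding carr_glue by (rule bij_betw_inl_inr) simp_all
  qed
  moreover have "opn ?G (opn ?G p q) (opn ?G p r) = opn ?G (opn ?G q p) (opn ?G q r)"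
    if pqr: "p \<in> carr ?G" "q \<in> carr ?G" "r \<in> carr ?G" for p q r
  proof -
    have \<alpha>_opn: "\<alpha> (opn X x z) = opn X (\<alpha> x) (\<alpha> z)" if "x \<in> carr X" "z \<in> carr X" for x z
      using \<alpha> that by (simp add: automorphism_def)
    have \<beta>_opn: "\<beta> (opn Y y z) = opn Y (\<beta> y) (\<beta> z)" if "y \<in> carr Y" "z \<in> carr Y" for y z
      using \<beta> that by (simp add: automorphism_def)
    show ?thesis
      using pqr unfolding carr_glue
      by (elim UnE imageE) (simp_all add: \<alpha>_opn \<beta>_opn cycle_law[OF X] cycle_law[OF Y])
  qed
  moreover have "carr ?G \<noteq> {}" using X by (simp add: left_cycle_set_def)
  ultimately show ?thesis unfolding left_cycle_set_def by blast
qed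

section \<open>The level of a gluing\<close>

locale gluing =
  fixes X :: "elt magma" and \<alpha> and Y :: "elt magma" and \<beta>
  assumes fin: "finite (carr X)" "finite (carr Y)"
    and lcs: "left_cycle_set X" "left_cycle_set Y"
    and aut: "automorphism X \<alpha>" "automorphism Y \<beta>"
begin

abbreviation "G \<equiv> glue X \<alpha> Y \<beta>"

lemma finite_G: "finite (carr G)"
  using fin by simp

lemma lcs_G: "left_cycle_set G"
  by (rule left_cycle_set_glue[OF lcs aut])

lemmas iter_sigma_G_Suc = iter_sigma_Suc_eq_iff[OF finite_G lcs_G]

text \<open>Elements of the same part act equally on the other part, so only their actions on their own
  part can distinguish them.\<close>

lemma iter_sigma_inl_inl:
  assumes "x \<in> carr X" and "x' \<in> carr X"
  shows "iter_sigma n G (inl x) = iter_sigma n G (inl x') \<longleftrightarrow> iter_sigma n X x = iter_sigma n X x'"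
  using assms
proof (induction n arbitrary: x x')
  case (Suc n)
  then show ?case
    by (simp add: iter_sigma_G_Suc iter_sigma_Suc_eq_iff[OF fin(1) lcs(1)] ball_Un opn_closed[OF lcs(1)]
        del: iter_sigma.simps)
qed simp

lemma iter_sigma_inr_inr:
  assumes "y \<in> carr Y" and "y' \<in> carr Y"
  shows "iter_sigma n G (inr y) = iter_sigma n G (inr y') \<longleftrightarrow> iter_sigma n Y y = iter_sigma n Y y'"
  using assms
proof (induction n arbitrary: y y')
  case (Suc n)
  then show ?case
    by (simp add: iter_sigma_G_Suc iter_sigma_Suc_eq_iff[OF fin(2) lcs(2)] ball_Un opn_closed[OF lcs(2)]
        del: iter_sigma.simps)
qed simp

lemma iter_sigma_Suc_inl_inr:
  assumes "x \<in> carr X" and "y \<in> carr Y"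
  shows "iter_sigma (Suc n) G (inl x) = iter_sigma (Suc n) G (inr y) \<longleftrightarrow>
    (\<forall>z\<in>carr X. iter_sigma n X (opn X x z) = iter_sigma n X (\<alpha> z)) \<and>
    (\<forall>z\<in>carr Y. iter_sigma n Y (\<beta> z) = iter_sigma n Y (opn Y y z))"
  using assms
  by (simp add: iter_sigma_G_Suc ball_Un opn_closed lcs automorphism_closed[OF aut(1)]
      automorphism_closed[OF aut(2)] iter_sigma_inl_inl iter_sigma_inr_inr del: iter_sigma.simps)

text \<open>If the two parts were mixed up at step \<open>n + 1 \<le> k + 1\<close>, then \<open>\<alpha>\<close> would be induced on \<open>\<sigma>\<^sup>n(X)\<close>,
  and therefore on \<open>\<sigma>\<^sup>k(X)\<close>, by a left multiplication of \<open>X\<close>, that is, by the identity.\<close>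

lemma iter_sigma_inl_neq_inr:
  assumes sf: "square_free X" and lev: "multiperm_level X (Suc k)"
    and w: "w \<in> carr X" "iter_sigma k X w \<noteq> iter_sigma k X (\<alpha> w)"
    and x: "x \<in> carr X" and y: "y \<in> carr Y" and n: "n \<le> Suc k"
  shows "iter_sigma n G (inl x) \<noteq> iter_sigma n G (inr y)"
proof (cases n)
  case (Suc n')
  show ?thesis
  proof
    assume "iter_sigma n G (inl x) = iter_sigma n G (inr y)"
    then have "iter_sigma n' X (opn X x w) = iter_sigma n' X (\<alpha> w)"
      using iter_sigma_Suc_inl_inr[OF x y] w(1) Suc by blast
    then have "iter_sigma k X (opn X x w) = iter_sigma k X (\<alpha> w)"
      by (rule iter_sigma_eq_mono) (use n Suc in simp)
    then show False
      using iter_sigma_opn_if_level_Suc[OF fin(1) lcs(1) sf lev x w(1)] w(2) by simp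
  qed
qed simp

lemma multiperm_level_glue:
  assumes sf: "square_free X" and lev: "multiperm_level X (Suc k)"
    and w: "w \<in> carr X" "iter_sigma k X w \<noteq> iter_sigma k X (\<alpha> w)"
    and Y: "\<And>y y'. y \<in> carr Y \<Longrightarrow> y' \<in> carr Y \<Longrightarrow> iter_sigma (Suc k) Y y = iter_sigma (Suc k) Y y'"
  shows "multiperm_level G (Suc (Suc k))"
proof -
  have X: "iter_sigma (Suc k) X x = iter_sigma (Suc k) X x'" if "x \<in> carr X" "x' \<in> carr X" for x x'
    using lcs(1) lev that by (rule iter_sigma_eq_if_level)
  have ll: "iter_sigma (Suc (Suc k)) G (inl x) = iter_sigma (Suc (Suc k)) G (inl x')"
    if "x \<in> carr X" "x' \<in> carr X" for x x'
    by (rule iter_sigma_eq_mono[of "Suc k"]) (use that X iter_sigma_inl_inl in blast, simp)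
  have rr: "iter_sigma (Suc (Suc k)) G (inr y) = iter_sigma (Suc (Suc k)) G (inr y')"
    if "y \<in> carr Y" "y' \<in> carr Y" for y y'
    by (rule iter_sigma_eq_mono[of "Suc k"]) (use that Y iter_sigma_inr_inr in blast, simp)
  have lr: "iter_sigma (Suc (Suc k)) G (inl x) = iter_sigma (Suc (Suc k)) G (inr y)"
    if "x \<in> carr X" "y \<in> carr Y" for x y
    unfolding iter_sigma_Suc_inl_inr[OF that]
    by (intro conjI ballI X Y opn_closed lcs automorphism_closed[OF aut(1)]
        automorphism_closed[OF aut(2)] that)
  have "iter_sigma (Suc (Suc k)) G p = iter_sigma (Suc (Suc k)) G q"
    if "p \<in> carr G" "q \<in> carr G" for p q
    using that unfolding carr_glue
    by (auto intro: ll rr lr lr[symmetric] simp del: iter_sigma.simps)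
  moreover obtain y where y: "y \<in> carr Y" using lcs(2) by (auto simp: left_cycle_set_def)
  moreover have "\<not> (\<forall>p\<in>carr G. \<forall>q\<in>carr G. iter_sigma j G p = iter_sigma j G q)"
    if j: "j < Suc (Suc k)" for j
  proof -
    have "iter_sigma j G (inl w) \<noteq> iter_sigma j G (inr y)"
      using iter_sigma_inl_neq_inr[OF sf lev w w(1) y] j by simp
    then show ?thesis using w(1) y unfolding carr_glue by blast
  qed
  ultimately show ?thesis
    unfolding multiperm_level_def card_iter_retraction_eq_1_iff[OF lcs_G] by blast
qed

end

section \<open>Adding a point and doubling\<close>

definition sf_level :: "nat \<Rightarrow> elt magma \<Rightarrow> bool" where
  "sf_level m X \<longleftrightarrow> finite (carr X) \<and> left_cycle_set X \<and> square_free X \<and> multiperm_level X m"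

definition sf_level_moved :: "nat \<Rightarrow> elt magma \<Rightarrow> bool" where
  "sf_level_moved k X \<longleftrightarrow> sf_level k X \<and>
     (\<exists>\<alpha>. automorphism X \<alpha> \<and> (\<exists>x\<in>carr X. iter_sigma (k - 1) X x \<noteq> iter_sigma (k - 1) X (\<alpha> x)))"

lemma N_min_eq: "N_min m = (LEAST n. \<exists>X. sf_level m X \<and> card (carr X) = n)"
  unfolding N_min_def sf_level_def by (intro arg_cong[where f = Least] ext iff_exI) blast

lemma Nbar_min_eq: "Nbar_min k = (LEAST n. \<exists>X. sf_level_moved k X \<and> card (carr X) = n)"
  unfolding Nbar_min_def sf_level_moved_def sf_level_def by (intro arg_cong[where f = Least] ext iff_exI) blast

lemma left_cycle_set_trivial: "A \<noteq> {} \<Longrightarrow> left_cycle_set (A, \<lambda>x y. y)"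
  by (simp add: left_cycle_set_def bij_betw_def)

lemma add_point:
  assumes "sf_level_moved (Suc k) X"
  shows "\<exists>Z. sf_level (Suc (Suc k)) Z \<and> card (carr Z) = card (carr X) + 1"
proof -
  from assms obtain \<alpha> w where X: "sf_level (Suc k) X" and \<alpha>: "automorphism X \<alpha>"
    and w: "w \<in> carr X" "iter_sigma k X w \<noteq> iter_sigma k X (\<alpha> w)"
    by (auto simp: sf_level_moved_def)
  define P :: "elt magma" where "P = ({Atom 0}, \<lambda>x y. y)"
  interpret gluing X \<alpha> P id
    using X \<alpha> left_cycle_set_trivial[of "{Atom 0}"]
    by unfold_locales (auto simp: sf_level_def P_def automorphism_def)
  have "multiperm_level G (Suc (Suc k))"
    using X w by (intro multiperm_level_glue) (auto simp: sf_level_def P_def)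
  moreover have "square_free G"
    using X by (intro square_free_glue) (auto simp: sf_level_def square_free_def P_def)
  moreover have "card (carr G) = card (carr X) + 1" by (simp only: card_glue[OF fin]) (simp add: P_def)
  ultimately show ?thesis using finite_G lcs_G unfolding sf_level_def by blast
qed

text \<open>Each copy acts on the other one by the same map \<open>\<alpha>\<close>, so exchanging the copies respects the
  operation.\<close>

lemma automorphism_swap:
  "automorphism (glue X \<alpha> X \<alpha>) (case_tag inr inl)"
proof -
  have "bij_betw (case_tag inr inl) (inl ` carr X \<union> inr ` carr X) (inl ` carr X \<union> inr ` carr X)"
    by (rule bij_betw_byWitness[where f' = "case_tag inr inl"]) auto
  then show ?thesis by (auto simp: automorphism_def)
qed

lemma doubling:
  assumes "sf_level_moved (Suc k) X"
  shows "\<exists>Z. sf_level_moved (Suc (Suc k)) Z \<and> card (carr Z) = 2 * card (carr X)"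
proof -
  from assms obtain \<alpha> w where X: "sf_level (Suc k) X" and \<alpha>: "automorphism X \<alpha>"
    and w: "w \<in> carr X" "iter_sigma k X w \<noteq> iter_sigma k X (\<alpha> w)"
    by (auto simp: sf_level_moved_def)
  interpret gluing X \<alpha> X \<alpha>
    using X \<alpha> by unfold_locales (auto simp: sf_level_def)
  have sf: "square_free X" and lev: "multiperm_level X (Suc k)"
    using X by (auto simp: sf_level_def)
  have "multiperm_level G (Suc (Suc k))"
    using sf lev w iter_sigma_eq_if_level[OF lcs(1) lev] by (rule multiperm_level_glue)
  moreover have "square_free G" using sf sf by (rule square_free_glue)
  ultimately have "sf_level (Suc (Suc k)) G"
    using finite_G lcs_G by (simp add: sf_level_def)
  moreover have "iter_sigma (Suc k) G (inl w) \<noteq> iter_sigma (Suc k) G (case_tag inr inl (inl w))"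
    using iter_sigma_inl_neq_inr[OF sf lev w w(1) w(1) order.refl] by (simp only: case_tag_simps not_False_eq_True)
  moreover have "inl w \<in> carr G" using w(1) by simp
  ultimately have "sf_level_moved (Suc (Suc k)) G"
    unfolding sf_level_moved_def diff_Suc_1 using automorphism_swap[of X \<alpha>] by blast
  moreover have "card (carr G) = 2 * card (carr X)" by (simp only: card_glue[OF fin] mult_2)
  ultimately show ?thesis by blast
qed

text \<open>For \<open>k = 1\<close> the automorphism only has to move some element of \<open>X\<close> itself.\<close>

lemma sf_level_moved_1: "\<exists>X. sf_level_moved 1 X"
proof -
  define X :: "elt magma" where "X = ({Atom 0, Atom 1}, \<lambda>x y. y)"
  define \<alpha> where "\<alpha> x = (if x = Atom 0 then Atom 1 else Atom 0)" for x
  have X: "left_cycle_set X" unfolding X_def by (rule left_cycle_set_trivial) simp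
  have "bij_betw \<alpha> (carr X) (carr X)"
    by (rule bij_betw_byWitness[where f' = \<alpha>]) (auto simp: X_def \<alpha>_def)
  then have "automorphism X \<alpha>" by (auto simp: automorphism_def X_def \<alpha>_def)
  moreover have "multiperm_level X 1"
    unfolding multiperm_level_def card_iter_retraction_eq_1_iff[OF X] by (auto simp: X_def lmul_eq_iff)
  then have "sf_level 1 X" using X by (simp add: sf_level_def square_free_def X_def)
  moreover have "\<exists>x\<in>carr X. iter_sigma (1 - 1) X x \<noteq> iter_sigma (1 - 1) X (\<alpha> x)"
    by (auto simp: X_def \<alpha>_def)
  ultimately show ?thesis unfolding sf_level_moved_def by blast
qed

lemma ex_sf_level_moved: "\<exists>X. sf_level_moved (Suc k) X"
proof (induction k)
  case (Suc k)
  then show ?case using doubling by blast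
qed (use sf_level_moved_1 in simp)

lemma Nbar_min_attained: "\<exists>X. sf_level_moved (Suc k) X \<and> card (carr X) = Nbar_min (Suc k)"
  unfolding Nbar_min_eq by (rule LeastI_ex) (use ex_sf_level_moved in blast)

lemma N_min_Suc_le: "N_min (Suc (Suc k)) \<le> Nbar_min (Suc k) + 1"
  unfolding N_min_eq by (rule Least_le) (use Nbar_min_attained add_point in metis)

lemma Nbar_min_Suc_le: "Nbar_min (Suc (Suc k)) \<le> 2 * Nbar_min (Suc k)"
  by (subst Nbar_min_eq, rule Least_le) (use Nbar_min_attained doubling in metis)

lemma Nbar_min_add_le: "Nbar_min (Suc k + d) \<le> Nbar_min (Suc k) * 2 ^ d"
proof (induction d)
  case (Suc d)
  then show ?case using Nbar_min_Suc_le[of "k + d"] by simp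
qed simp

theorem theorem9:
  fixes k m :: nat
  assumes "0 < k" and "k < m"
  shows "N_min m \<le> Nbar_min k * 2 ^ (m - k - 1) + 1"
proof -
  obtain k' where k: "k = Suc k'" using assms(1) gr0_implies_Suc by blast
  define d where "d = m - k - 1"
  have m: "m = Suc (Suc (k' + d))" using assms(2) k by (simp add: d_def)
  have "N_min m \<le> Nbar_min (Suc k' + d) + 1" using N_min_Suc_le[of "k' + d"] m by simp
  also have "\<dots> \<le> Nbar_min k * 2 ^ d + 1" using Nbar_min_add_le[of k' d] k by simp
  finally show ?thesis by (simp add: d_def)
qed

end
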